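(* Let $g:[0,\infty)\to\mathbb{R}$ be monotonic nondecreasing. Then $$\delta_g(Q,P)\ \ge\ \max\left\{\left|\bar\delta_g(Q,P)-V(Q,P)\,I_g(Q,P)\right|,\ \left|\bar\delta_{|g|}(Q,P)-V(Q,P)\,I_{|g|}(Q,P)\right|\right\}\ \ge\ 0$$ for any $P,Q\in\mathcal{P}$.
   Context: $(X,\mathcal{A})$ is a measurable space with $|\mathcal{A}|>2$ and $\mu$ is a $\sigma$-finite measure on it. $\mathcal{P}$ is the set of all probability measures on $(X,\mathcal{A})$ which are absolutely continuous with respect to $\mu$; for $P,Q\in\mathcal{P}$, $p=\frac{dP}{d\mu}$ and $q=\frac{dQ}{d\mu}$ denote the Radon-Nikodym derivatives. For a measurable function $h:[0,\infty)\to\mathbb{R}$ define the $h$-divergence, the $\delta$-divergence and the absolute $\delta$-divergence by $$I_h(Q,P)=\int_X p(x)\,h\!\left[\frac{q(x)}{p(x)}\right]d\mu(x),\quad \delta_h(Q,P)=\int_X [q(x)-p(x)]\, h\!\left[\frac{q(x)}{p(x)}\right]d\mu(x),$$ $$\bar\delta_h(Q,P)=\int_X |q(x)-p(x)|\, h\!\left[\frac{q(x)}{p(x)}\right]d\mu(x).$$ $V(Q,P)=\int_X|q-p|\,d\mu$ is the total variation distance, and $|g|$ denotes the function $t\mapsto|g(t)|$. *)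

theory Defs
  imports "HOL-Probability.Probability"
begin

definition prob_measures_ac :: "'a measure \<Rightarrow> 'a measure set" where
  "prob_measures_ac \<mu> =
     {P. prob_space P \<and> sets P = sets \<mu> \<and> absolutely_continuous \<mu> P}"

text \<open>The Radon-Nikodym derivative as a real function; the library version takes values in the
  extended nonnegative reals, but is finite almost everywhere for the measures considered here.\<close>

definition dens :: "'a measure \<Rightarrow> 'a measure \<Rightarrow> 'a \<Rightarrow> real" where
  "dens \<mu> P x = enn2real (RN_deriv \<mu> P x)"

text \<open>The integral with values in the extended reals: integral of the positive part minus integral
  of the negative part (\<^const>\<open>e2ennreal\<close> truncates negative values to 0). It is
  meaningful unless both parts have infinite integral.\<close>

definition ext_integral :: "'a measure \<Rightarrow> ('a \<Rightarrow> ereal) \<Rightarrow> ereal" where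
  "ext_integral M f =
     enn2ereal (\<integral>\<^sup>+ x. e2ennreal (f x) \<partial>M) - enn2ereal (\<integral>\<^sup>+ x. e2ennreal (- f x) \<partial>M)"

text \<open>Functions on the half-line [0,\<infinity>) are represented by functions on all reals; only
  their values on the half-line are used, since densities are nonnegative.

  At points with p = 0 the quotient q/p is undefined and the integrands are read by the usual
  convention for f-divergences,
    0 h(0/0) = 0   and   0 h(q/0) = q lim h(t)/t   as t tends to infinity.
  The other two divergences are the f-divergences of (t-1) h(t) and |t-1| h(t), for which the
  convention gives q lim h(t). In the extended reals 0 * \<infinity> = 0, which covers q = 0. The
  upper limit is used only to make the definitions total; it is the limit whenever that exists.\<close>

definition h_div :: "'a measure \<Rightarrow> (real \<Rightarrow> real) \<Rightarrow> 'a measure \<Rightarrow> 'a measure \<Rightarrow> ereal" where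
  "h_div \<mu> h Q P = ext_integral \<mu> (\<lambda>x.
     let p = dens \<mu> P x; q = dens \<mu> Q x in
       if p > 0 then ereal (p * h (q / p))
       else ereal q * Limsup at_top (\<lambda>t. ereal (h t / t)))"

definition delta_div :: "'a measure \<Rightarrow> (real \<Rightarrow> real) \<Rightarrow> 'a measure \<Rightarrow> 'a measure \<Rightarrow> ereal" where
  "delta_div \<mu> h Q P = ext_integral \<mu> (\<lambda>x.
     let p = dens \<mu> P x; q = dens \<mu> Q x in
       if p > 0 then ereal ((q - p) * h (q / p))
       else ereal q * Limsup at_top (\<lambda>t. ereal (h t)))"

definition abs_delta_div :: "'a measure \<Rightarrow> (real \<Rightarrow> real) \<Rightarrow> 'a measure \<Rightarrow> 'a measure \<Rightarrow> ereal" where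
  "abs_delta_div \<mu> h Q P = ext_integral \<mu> (\<lambda>x.
     let p = dens \<mu> P x; q = dens \<mu> Q x in
       if p > 0 then ereal (\<bar>q - p\<bar> * h (q / p))
       else ereal q * Limsup at_top (\<lambda>t. ereal (h t)))"

definition total_var :: "'a measure \<Rightarrow> 'a measure \<Rightarrow> 'a measure \<Rightarrow> real" where
  "total_var \<mu> Q P = (\<integral>x. \<bar>dens \<mu> Q x - dens \<mu> P x\<bar> \<partial>\<mu>)"

end

theory Submission
  imports Defs
begin

text \<open>If the left-hand side is infinite there is nothing to show. Otherwise all integrals are finite,
  and with G = g(q/p), A = |q - p| and H = g(q/p) or |g(q/p)| both sides are double integrals:
  twice the Chebyshev functional of (A, H) integrates (A(x)p(y) - A(y)p(x))(H(x) - H(y)), and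
  twice the left-hand side integrates (q(x)p(y) - q(y)p(x))(G(x) - G(y)). The latter integrand is
  nonnegative because g is monotone, and it dominates the former by the reverse triangle
  inequality.\<close>

section \<open>Passing between extended and real integrals\<close>

text \<open>Integrability of \<open>F\<close> makes the integrals of its positive and negative parts
  finite, so the extended difference is a difference of reals. Equality is asked only almost
  everywhere, since the integrand of a divergence may be infinite on a null set.\<close>

lemma ext_integral_eq_integral:
  fixes F :: "'a \<Rightarrow> real"
  assumes F: "integrable M F" and eq: "AE x in M. f x = ereal (F x)"
  shows "ext_integral M f = ereal (\<integral>x. F x \<partial>M)"
proof -
  have "(\<integral>\<^sup>+x. e2ennreal (f x) \<partial>M) = (\<integral>\<^sup>+x. ennreal (F x) \<partial>M)"
    by (rule nn_integral_cong_AE, use eq in eventually_elim) (simp add: e2ennreal_ereal)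
  moreover have "(\<integral>\<^sup>+x. e2ennreal (- f x) \<partial>M) = (\<integral>\<^sup>+x. ennreal (- F x) \<partial>M)"
    by (rule nn_integral_cong_AE, use eq in eventually_elim) (simp add: e2ennreal_ereal)
  moreover have "(\<integral>\<^sup>+x. ennreal (F x) \<partial>M) \<noteq> \<infinity>" "(\<integral>\<^sup>+x. ennreal (- F x) \<partial>M) \<noteq> \<infinity>"
    using F by (auto simp: real_integrable_def)
  then have "enn2ereal (\<integral>\<^sup>+x. ennreal (F x) \<partial>M) = ereal (enn2real (\<integral>\<^sup>+x. ennreal (F x) \<partial>M))"
    "enn2ereal (\<integral>\<^sup>+x. ennreal (- F x) \<partial>M) = ereal (enn2real (\<integral>\<^sup>+x. ennreal (- F x) \<partial>M))"
    by (metis ennreal_enn2real_if enn2ereal_ennreal enn2real_nonneg infinity_ennreal_def)+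
  ultimately show ?thesis
    using F by (simp add: ext_integral_def real_lebesgue_integral_def)
qed

text \<open>The integrable minorant \<open>w\<close> keeps the integral of the negative part finite.
  The value can then avoid \<infinity> only if the positive part has finite integral too. Pointwise,
  \<open>w\<close> rules out -\<infinity> everywhere, and \<infinity> is possible only on a null
  set.\<close>

lemma ext_integral_finite_imp_integrable:
  fixes f :: "'a \<Rightarrow> ereal"
  assumes f[measurable]: "f \<in> borel_measurable M"
    and w: "integrable M w" and le: "\<And>x. x \<in> space M \<Longrightarrow> ereal (w x) \<le> f x"
    and fin: "ext_integral M f \<noteq> \<infinity>"
  shows "AE x in M. f x = ereal (real_of_ereal (f x))"
    and "integrable M (\<lambda>x. real_of_ereal (f x))"
proof -
  have "(\<integral>\<^sup>+x. e2ennreal (- f x) \<partial>M) \<le> (\<integral>\<^sup>+x. ennreal (- w x) \<partial>M)"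
  proof (rule nn_integral_mono)
    fix x assume "x \<in> space M"
    then have "- f x \<le> ereal (- w x)"
      using le[of x] by (metis ereal_minus_le_minus uminus_ereal.simps(1))
    then show "e2ennreal (- f x) \<le> ennreal (- w x)"
      by (metis e2ennreal_ereal e2ennreal_mono)
  qed
  also have "\<dots> < \<infinity>"
    using w by (simp add: real_integrable_def top.not_eq_extremum)
  finally have neg: "(\<integral>\<^sup>+x. e2ennreal (- f x) \<partial>M) < \<infinity>" .
  have pos: "(\<integral>\<^sup>+x. e2ennreal (f x) \<partial>M) \<noteq> \<infinity>"
  proof
    assume "(\<integral>\<^sup>+x. e2ennreal (f x) \<partial>M) = \<infinity>"
    then show False
      using fin neg by (simp add: ext_integral_def)
  qed
  have "AE x in M. e2ennreal (f x) \<noteq> \<infinity>"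
    using pos by (intro nn_integral_PInf_AE) auto
  then show ae: "AE x in M. f x = ereal (real_of_ereal (f x))"
  proof (rule AE_mp, intro AE_I2 impI)
    fix x assume "x \<in> space M" "e2ennreal (f x) \<noteq> \<infinity>"
    then show "f x = ereal (real_of_ereal (f x))"
      using le[of x] by (cases "f x") auto
  qed
  have "(\<integral>\<^sup>+x. ennreal (real_of_ereal (f x)) \<partial>M) = (\<integral>\<^sup>+x. e2ennreal (f x) \<partial>M)"
    by (rule nn_integral_cong_AE, use ae in eventually_elim) (metis e2ennreal_ereal)
  moreover have "(\<integral>\<^sup>+x. ennreal (- real_of_ereal (f x)) \<partial>M) = (\<integral>\<^sup>+x. e2ennreal (- f x) \<partial>M)"
    by (rule nn_integral_cong_AE, use ae in eventually_elim)
      (metis e2ennreal_ereal uminus_ereal.simps(1))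
  ultimately show "integrable M (\<lambda>x. real_of_ereal (f x))"
    using pos neg by (simp add: real_integrable_def)
qed

section \<open>The Chebyshev functional as an iterated integral\<close>

text \<open>The integrand expands into four products of a function of x and a function of y, so
  linearity alone evaluates the iterated integral, without Fubini or a product measure. The four
  terms give two pairs of equal values, whence the factor 2.\<close>

lemma integral_antisymmetric_form:
  fixes a p H :: "'a \<Rightarrow> real"
  assumes [simp]: "integrable M a" "integrable M p"
    "integrable M (\<lambda>x. a x * H x)" "integrable M (\<lambda>x. p x * H x)"
  shows "integrable M (\<lambda>x. (a x * p y - a y * p x) * (H x - H y))"
    and "integrable M (\<lambda>y. \<integral>x. (a x * p y - a y * p x) * (H x - H y) \<partial>M)"
    and "(\<integral>y. (\<integral>x. (a x * p y - a y * p x) * (H x - H y) \<partial>M) \<partial>M) =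
      2 * ((\<integral>x. a x * H x \<partial>M) * (\<integral>x. p x \<partial>M) - (\<integral>x. a x \<partial>M) * (\<integral>x. p x * H x \<partial>M))"
proof -
  have expand: "(\<lambda>x. (a x * p y - a y * p x) * (H x - H y)) =
    (\<lambda>x. p y * (a x * H x) - (p y * H y) * a x - a y * (p x * H x) + (a y * H y) * p x)" for y
    by (auto simp: algebra_simps)
  show "integrable M (\<lambda>x. (a x * p y - a y * p x) * (H x - H y))"
    unfolding expand by simp
  have inner: "(\<lambda>y. \<integral>x. (a x * p y - a y * p x) * (H x - H y) \<partial>M) =
    (\<lambda>y. p y * (\<integral>x. a x * H x \<partial>M) - (p y * H y) * (\<integral>x. a x \<partial>M)
      - a y * (\<integral>x. p x * H x \<partial>M) + (a y * H y) * (\<integral>x. p x \<partial>M))"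
    unfolding expand by simp
  show "integrable M (\<lambda>y. \<integral>x. (a x * p y - a y * p x) * (H x - H y) \<partial>M)"
    unfolding inner by simp
  show "(\<integral>y. (\<integral>x. (a x * p y - a y * p x) * (H x - H y) \<partial>M) \<partial>M) =
      2 * ((\<integral>x. a x * H x \<partial>M) * (\<integral>x. p x \<partial>M) - (\<integral>x. a x \<partial>M) * (\<integral>x. p x * H x \<partial>M))"
    unfolding inner by simp
qed

text \<open>Since p and q have integral 1, the form for (q, G) is twice the right-hand side, and the
  form for (|q - p|, H) is twice the difference on the left. The pointwise comparison is available
  only for pairs satisfying \<open>R\<close>; it is integrated first over almost every x with y
  fixed, then over almost every y.\<close>

lemma chebyshev_functional_bound:
  fixes p q G H :: "'a \<Rightarrow> real"
  assumes int: "integrable M p" "integrable M q"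
    "integrable M (\<lambda>x. p x * G x)" "integrable M (\<lambda>x. q x * G x)"
    "integrable M (\<lambda>x. p x * H x)" "integrable M (\<lambda>x. \<bar>q x - p x\<bar> * H x)"
    and one: "(\<integral>x. p x \<partial>M) = 1" "(\<integral>x. q x \<partial>M) = 1"
    and p: "\<And>x. 0 \<le> p x"
    and ae: "AE x in M. R x"
    and mono: "\<And>x y. R x \<Longrightarrow> R y \<Longrightarrow> 0 \<le> (q x * p y - q y * p x) * (G x - G y)"
    and HG: "\<And>x y. R x \<Longrightarrow> R y \<Longrightarrow> \<bar>H x - H y\<bar> \<le> \<bar>G x - G y\<bar>"
  shows "\<bar>(\<integral>x. \<bar>q x - p x\<bar> * H x \<partial>M) - (\<integral>x. \<bar>q x - p x\<bar> \<partial>M) * (\<integral>x. p x * H x \<partial>M)\<bar>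
    \<le> (\<integral>x. (q x - p x) * G x \<partial>M)"
proof -
  define a where "a x = \<bar>q x - p x\<bar>" for x
  define A where "A x y = (a x * p y - a y * p x) * (H x - H y)" for x y
  define B where "B x y = (q x * p y - q y * p x) * (G x - G y)" for x y
  have a: "integrable M a" "integrable M (\<lambda>x. a x * H x)"
    using int unfolding a_def by auto
  note A = integral_antisymmetric_form[OF a(1) int(1) a(2) int(5), folded A_def]
  note B = integral_antisymmetric_form[OF int(2) int(1) int(4) int(3), folded B_def]
  have AB: "\<bar>A x y\<bar> \<le> B x y" if "R x" "R y" for x y
  proof -
    \<comment> \<open>Nonnegativity of p moves it inside the absolute value. Both expressions then
      subtract the same p x * p y, which cancels in the reverse triangle inequality.\<close>
    have "a x * p y = \<bar>q x * p y - p x * p y\<bar>" "a y * p x = \<bar>q y * p x - p x * p y\<bar>"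
      using abs_mult_pos[OF p, of "q x - p x" y] abs_mult_pos[OF p, of "q y - p y" x]
      by (simp_all add: a_def right_diff_distrib mult.commute)
    then have "\<bar>a x * p y - a y * p x\<bar> \<le> \<bar>q x * p y - q y * p x\<bar>"
      by linarith
    then have "\<bar>A x y\<bar> \<le> \<bar>q x * p y - q y * p x\<bar> * \<bar>G x - G y\<bar>"
      unfolding A_def abs_mult using HG[OF that] by (intro mult_mono) auto
    also have "\<dots> = B x y"
      using mono[OF that] by (simp add: B_def abs_mult[symmetric])
    finally show ?thesis .
  qed
  have "\<bar>\<integral>x. A x y \<partial>M\<bar> \<le> (\<integral>x. B x y \<partial>M)" if "R y" for y
  proof -
    have "\<bar>\<integral>x. A x y \<partial>M\<bar> \<le> (\<integral>x. \<bar>A x y\<bar> \<partial>M)"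
      by (rule integral_abs_bound)
    also have "\<dots> \<le> (\<integral>x. B x y \<partial>M)"
      by (rule integral_mono_AE) (use A(1) B(1) ae AB that in auto)
    finally show ?thesis .
  qed
  then have "(\<integral>y. \<bar>\<integral>x. A x y \<partial>M\<bar> \<partial>M) \<le> (\<integral>y. (\<integral>x. B x y \<partial>M) \<partial>M)"
    by (intro integral_mono_AE) (use A(2) B(2) ae in auto)
  then have "\<bar>\<integral>y. (\<integral>x. A x y \<partial>M) \<partial>M\<bar> \<le> (\<integral>y. (\<integral>x. B x y \<partial>M) \<partial>M)"
    using integral_abs_bound[of M "\<lambda>y. \<integral>x. A x y \<partial>M"] by linarith
  moreover have "(\<integral>x. (q x - p x) * G x \<partial>M) = (\<integral>x. q x * G x \<partial>M) - (\<integral>x. p x * G x \<partial>M)"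
    using int by (simp add: left_diff_distrib)
  ultimately show ?thesis
    unfolding A(3) B(3) one by (simp add: a_def[abs_def])
qed

section \<open>Densities and functions of their ratio\<close>

lemma dens_nonneg [simp]: "0 \<le> dens \<mu> P x"
  by (simp add: dens_def)

lemma dens_pos_iff: "0 < dens \<mu> P x \<longleftrightarrow> dens \<mu> P x \<noteq> 0"
  using dens_nonneg[of \<mu> P x] by linarith

lemma measurable_dens [measurable]: "dens \<mu> P \<in> borel_measurable \<mu>"
  unfolding dens_def by measurable

text \<open>The Radon-Nikodym derivative is finite almost everywhere because P is \<sigma>-finite.
  Hence \<open>enn2real\<close> alters it only on a null set, and its integral is the total mass of
  P.\<close>

lemma dens_prob:
  assumes "sigma_finite_measure \<mu>" "P \<in> prob_measures_ac \<mu>"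
  shows "integrable \<mu> (dens \<mu> P)" "(\<integral>x. dens \<mu> P x \<partial>\<mu>) = 1"
proof -
  interpret \<mu>: sigma_finite_measure \<mu> by fact
  have P: "prob_space P" "sets P = sets \<mu>" "absolutely_continuous \<mu> P"
    using assms(2) by (auto simp: prob_measures_ac_def)
  interpret P: prob_space P by fact
  have "AE x in \<mu>. RN_deriv \<mu> P x \<noteq> \<infinity>"
    by (rule \<mu>.RN_deriv_finite) (use P P.sigma_finite_measure in auto)
  then have "(\<integral>\<^sup>+x. ennreal (dens \<mu> P x) \<partial>\<mu>) = (\<integral>\<^sup>+x. RN_deriv \<mu> P x \<partial>\<mu>)"
    by (intro nn_integral_cong_AE, elim AE_mp) (auto simp: dens_def top.not_eq_extremum)
  also have "\<dots> = emeasure P (space \<mu>)"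
    using \<mu>.RN_deriv_nn_integral[OF P(3,2), of "\<lambda>x. 1"] sets_eq_imp_space_eq[OF P(2)] by simp
  also have "\<dots> = 1"
    using P.emeasure_space_1 sets_eq_imp_space_eq[OF P(2)] by simp
  finally have "has_bochner_integral \<mu> (dens \<mu> P) 1"
    by (intro has_bochner_integral_nn_integral) auto
  then show "integrable \<mu> (dens \<mu> P)" "(\<integral>x. dens \<mu> P x \<partial>\<mu>) = 1"
    by (auto simp: has_bochner_integral_iff)
qed

text \<open>The value \<open>c\<close> at points with p = 0 stands for the limit of \<open>h\<close> at infinity.\<close>

definition comp_ratio ::
  "'a measure \<Rightarrow> 'a measure \<Rightarrow> 'a measure \<Rightarrow> (real \<Rightarrow> real) \<Rightarrow> real \<Rightarrow> 'a \<Rightarrow> real" where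
  "comp_ratio \<mu> Q P h c x = (if dens \<mu> P x > 0 then h (dens \<mu> Q x / dens \<mu> P x) else c)"

lemma abs_comp_ratio:
  "comp_ratio \<mu> Q P (\<lambda>t. \<bar>h t\<bar>) \<bar>c\<bar> x = \<bar>comp_ratio \<mu> Q P h c x\<bar>"
  by (simp add: comp_ratio_def)

text \<open>Nothing is known about g on negative arguments. Replacing g there by the constant g 0
  gives a function monotone on the whole line, hence Borel, which agrees with g on the range of
  f.\<close>

lemma borel_measurable_mono_on_comp:
  fixes g :: "real \<Rightarrow> real"
  assumes "mono_on {0..} g" "f \<in> borel_measurable M" "\<And>x. 0 \<le> f x"
  shows "(\<lambda>x. g (f x)) \<in> borel_measurable M"
proof -
  have "mono (\<lambda>t. g (max 0 t))"
    by (intro monoI mono_onD[OF assms(1)]) auto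
  then have "(\<lambda>t. g (max 0 t)) \<in> borel_measurable borel"
    by (rule borel_measurable_mono)
  then have "(\<lambda>x. g (max 0 (f x))) \<in> borel_measurable M"
    using assms(2) by measurable
  then show ?thesis
    using assms(3) by (simp add: max_absorb2)
qed

lemma measurable_comp_ratio:
  assumes "mono_on {0..} g"
  shows "comp_ratio \<mu> Q P g c \<in> borel_measurable \<mu>"
proof -
  have [measurable]: "(\<lambda>x. g (dens \<mu> Q x / dens \<mu> P x)) \<in> borel_measurable \<mu>"
    by (rule borel_measurable_mono_on_comp[OF assms]) auto
  show ?thesis
    unfolding comp_ratio_def by measurable
qed

section \<open>Divergences as real integrals\<close>

text \<open>Where p = 0 the real integrand vanishes, and so does the conventional one: either q = 0,
  and 0 times any extended real is 0, or h has a finite limit, so that h t / t tends to 0.\<close>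

lemma h_div_eq_integral:
  assumes "integrable \<mu> (\<lambda>x. dens \<mu> P x * comp_ratio \<mu> Q P h c x)"
    and "AE x in \<mu>. dens \<mu> P x > 0 \<or> dens \<mu> Q x = 0 \<or> (h \<longlongrightarrow> c) at_top"
  shows "h_div \<mu> h Q P = ereal (\<integral>x. dens \<mu> P x * comp_ratio \<mu> Q P h c x \<partial>\<mu>)"
  unfolding h_div_def
proof (rule ext_integral_eq_integral[OF assms(1)], use assms(2) in eventually_elim)
  fix x assume x: "dens \<mu> P x > 0 \<or> dens \<mu> Q x = 0 \<or> (h \<longlongrightarrow> c) at_top"
  have "Limsup at_top (\<lambda>t. ereal (h t / t)) = 0" if "(h \<longlongrightarrow> c) at_top"
  proof -
    have "((\<lambda>t. h t / t) \<longlongrightarrow> 0) at_top"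
      using that filterlim_at_top_imp_at_infinity[OF filterlim_ident] by (rule tendsto_divide_0)
    then have "((\<lambda>t. ereal (h t / t)) \<longlongrightarrow> 0) at_top"
      by (simp add: zero_ereal_def)
    then show ?thesis
      by (rule lim_imp_Limsup[rotated]) simp
  qed
  with x show "(let p = dens \<mu> P x; q = dens \<mu> Q x in if p > 0 then ereal (p * h (q / p))
      else ereal q * Limsup at_top (\<lambda>t. ereal (h t / t))) =
    ereal (dens \<mu> P x * comp_ratio \<mu> Q P h c x)"
    by (auto simp: comp_ratio_def Let_def dens_pos_iff simp flip: zero_ereal_def)
qed

text \<open>Where p = 0 the weight |q - p| is q and the other factor is \<open>c\<close>. This
  matches the convention because \<open>c\<close> is the limit of h unless q = 0.\<close>

lemma abs_delta_div_eq_integral: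
  assumes "integrable \<mu> (\<lambda>x. \<bar>dens \<mu> Q x - dens \<mu> P x\<bar> * comp_ratio \<mu> Q P h c x)"
    and "AE x in \<mu>. dens \<mu> P x > 0 \<or> dens \<mu> Q x = 0 \<or> (h \<longlongrightarrow> c) at_top"
  shows "abs_delta_div \<mu> h Q P =
    ereal (\<integral>x. \<bar>dens \<mu> Q x - dens \<mu> P x\<bar> * comp_ratio \<mu> Q P h c x \<partial>\<mu>)"
  unfolding abs_delta_div_def
proof (rule ext_integral_eq_integral[OF assms(1)], use assms(2) in eventually_elim)
  fix x assume x: "dens \<mu> P x > 0 \<or> dens \<mu> Q x = 0 \<or> (h \<longlongrightarrow> c) at_top"
  have "Limsup at_top (\<lambda>t. ereal (h t)) = ereal c" if "(h \<longlongrightarrow> c) at_top"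
    using that by (intro lim_imp_Limsup) auto
  with x show "(let p = dens \<mu> P x; q = dens \<mu> Q x in if p > 0 then ereal (\<bar>q - p\<bar> * h (q / p))
      else ereal q * Limsup at_top (\<lambda>t. ereal (h t))) =
    ereal (\<bar>dens \<mu> Q x - dens \<mu> P x\<bar> * comp_ratio \<mu> Q P h c x)"
    by (auto simp: comp_ratio_def Let_def dens_pos_iff simp flip: zero_ereal_def)
qed

section \<open>Monotone functions at infinity\<close>

lemma mono_on_le_Limsup_at_top:
  fixes g :: "real \<Rightarrow> real"
  assumes "mono_on {0..} g" "0 \<le> t"
  shows "ereal (g t) \<le> Limsup at_top (\<lambda>s. ereal (g s))"
proof -
  have "eventually (\<lambda>s. ereal (g t) \<le> ereal (g s)) at_top"
    using eventually_ge_at_top[of t]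
    by eventually_elim (use assms in \<open>auto intro: mono_onD\<close>)
  then show ?thesis
    by (intro le_Limsup) auto
qed

text \<open>A monotone function cannot oscillate: once it reaches a level c strictly between its
  lower and upper limits it never drops below c again, so the lower limit would be at least
  c.\<close>

lemma mono_on_tendsto_at_top:
  fixes g :: "real \<Rightarrow> real"
  assumes "mono_on {0..} g" "Limsup at_top (\<lambda>s. ereal (g s)) = ereal l"
  shows "(g \<longlongrightarrow> l) at_top"
proof -
  have "Limsup at_top (\<lambda>s. ereal (g s)) \<le> Liminf at_top (\<lambda>s. ereal (g s))"
  proof (rule ccontr)
    assume "\<not> ?thesis"
    then obtain c where c: "Liminf at_top (\<lambda>s. ereal (g s)) < c" "c < ereal l"
      using assms(2) dense by (metis not_le)
    have "\<exists>t\<ge>0. c \<le> ereal (g t)"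
    proof (rule ccontr)
      assume "\<not> ?thesis"
      then have "\<And>s. 0 \<le> s \<Longrightarrow> ereal (g s) \<le> c"
        by (meson linear)
      then have "eventually (\<lambda>s. ereal (g s) \<le> c) at_top"
        by (rule eventually_mono[OF eventually_ge_at_top])
      then have "ereal l \<le> c"
        unfolding assms(2)[symmetric] by (rule Limsup_bounded)
      with c show False by simp
    qed
    then obtain t where t: "0 \<le> t" "c \<le> ereal (g t)" by auto
    have "eventually (\<lambda>s. c \<le> ereal (g s)) at_top"
      using eventually_ge_at_top[of t]
    proof eventually_elim
      case (elim s)
      have "g t \<le> g s"
        using assms(1) t elim by (auto intro: mono_onD)
      then show ?case
        using t(2) order_trans by fastforce
    qed
    then have "c \<le> Liminf at_top (\<lambda>s. ereal (g s))"
      by (rule Liminf_bounded)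
    with c show False by simp
  qed
  moreover have "Liminf at_top (\<lambda>s. ereal (g s)) \<le> Limsup at_top (\<lambda>s. ereal (g s))"
    by (rule Liminf_le_Limsup) simp
  ultimately have "((\<lambda>s. ereal (g s)) \<longlongrightarrow> ereal l) at_top"
    using assms(2) by (intro Liminf_eq_Limsup) auto
  then show ?thesis by simp
qed

section \<open>Integrability and monotonicity for the composed ratio\<close>

text \<open>The weight q - p controls p except where q is close to p. There q / p stays in a compact
  interval around 1, on which the monotone g is bounded, so a multiple of p is an integrable
  majorant.\<close>

lemma integrable_dens_mult_comp_ratio:
  assumes g: "mono_on {0..} g" and p: "integrable \<mu> (dens \<mu> P)"
    and int: "integrable \<mu> (\<lambda>x. (dens \<mu> Q x - dens \<mu> P x) * comp_ratio \<mu> Q P g c x)"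
  shows "integrable \<mu> (\<lambda>x. dens \<mu> P x * comp_ratio \<mu> Q P g c x)"
proof -
  \<comment> \<open>On [1/2, 3/2] the values of g lie between those at the endpoints, so this sum
    bounds |g| there.\<close>
  define C where "C = \<bar>g (1/2)\<bar> + \<bar>g (3/2)\<bar>"
  note [measurable] = measurable_comp_ratio[OF g]
  have bound: "\<bar>dens \<mu> P x * comp_ratio \<mu> Q P g c x\<bar> \<le>
    2 * \<bar>(dens \<mu> Q x - dens \<mu> P x) * comp_ratio \<mu> Q P g c x\<bar> + C * dens \<mu> P x" (is "?l \<le> ?r") for x
  proof -
    define p q G where "p = dens \<mu> P x" and "q = dens \<mu> Q x" and "G = comp_ratio \<mu> Q P g c x"
    have pq: "0 \<le> p" "0 \<le> q" and C: "0 \<le> C"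
      by (auto simp: p_def q_def C_def)
    have "\<bar>p * G\<bar> \<le> 2 * \<bar>(q - p) * G\<bar> + C * p"
    \<comment> \<open>All points with p = 0 fall into the first case. The second case means |q - p|
      < p / 2, which forces p > 0 and places q / p between 1/2 and 3/2.\<close>
    proof (cases "p \<le> 2 * \<bar>q - p\<bar>")
      case True
      then have "\<bar>p * G\<bar> \<le> 2 * \<bar>(q - p) * G\<bar>"
        unfolding abs_mult using pq by (simp add: mult_right_mono flip: mult.assoc)
      then show ?thesis
        using pq C by (simp add: add_increasing2)
    next
      case False
      then have p: "0 < p" and "p \<le> 2 * q" "2 * q \<le> 3 * p"
        using pq by (auto simp: abs_if split: if_splits)
      then have q: "1/2 \<le> q / p" "q / p \<le> 3/2"
        by (simp_all add: field_simps)
      have "G = g (q / p)"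
        using p by (simp add: G_def comp_ratio_def p_def q_def)
      moreover have "g (1/2) \<le> g (q / p)" "g (q / p) \<le> g (3/2)"
        using g p pq q by (auto intro!: mono_onD[OF g])
      ultimately have "\<bar>G\<bar> \<le> C"
        unfolding C_def by linarith
      then have "\<bar>p * G\<bar> \<le> C * p"
        using p by (simp add: abs_mult mult.commute mult_right_mono)
      then show ?thesis by simp
    qed
    then show ?thesis
      by (simp add: p_def q_def G_def)
  qed
  show ?thesis
    by (rule Bochner_Integration.integrable_bound
          [where f = "\<lambda>x. 2 * \<bar>(dens \<mu> Q x - dens \<mu> P x) * comp_ratio \<mu> Q P g c x\<bar> + C * dens \<mu> P x"])
      (use bound p int in \<open>auto intro!: AE_I2 order_trans[OF bound abs_ge_self]\<close>)
qed

text \<open>The integrand has an integrable minorant, so a value other than \<infinity> makes it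
  integrable. If the upper limit of g is infinite, \<open>l\<close> takes the default value 0. This
  is harmless: by the first conclusion the points with p = 0 and q > 0 then form a null set.\<close>

lemma delta_div_finite_imp_integrable:
  assumes P: "integrable \<mu> (dens \<mu> P)" and Q: "integrable \<mu> (dens \<mu> Q)"
    and g: "mono_on {0..} g" and fin: "delta_div \<mu> g Q P \<noteq> \<infinity>"
  defines "l \<equiv> real_of_ereal (Limsup at_top (\<lambda>t. ereal (g t)))"
  shows "AE x in \<mu>. dens \<mu> P x > 0 \<or> dens \<mu> Q x = 0 \<or> (g \<longlongrightarrow> l) at_top"
    and "integrable \<mu> (\<lambda>x. (dens \<mu> Q x - dens \<mu> P x) * comp_ratio \<mu> Q P g l x)"
    and "delta_div \<mu> g Q P =
      ereal (\<integral>x. (dens \<mu> Q x - dens \<mu> P x) * comp_ratio \<mu> Q P g l x \<partial>\<mu>)"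
proof -
  define L where "L = Limsup at_top (\<lambda>t. ereal (g t))"
  define f where "f x = (let p = dens \<mu> P x; q = dens \<mu> Q x in
    if p > 0 then ereal ((q - p) * g (q / p)) else ereal q * L)" for x
  have delta: "delta_div \<mu> g Q P = ext_integral \<mu> f"
    unfolding delta_div_def f_def[abs_def] L_def ..
  have [measurable]: "(\<lambda>x. g (dens \<mu> Q x / dens \<mu> P x)) \<in> borel_measurable \<mu>"
    by (rule borel_measurable_mono_on_comp[OF g]) auto
  have meas: "f \<in> borel_measurable \<mu>"
    unfolding f_def[abs_def] Let_def by measurable
  have L: "ereal (g 1) \<le> L"
    unfolding L_def using g by (rule mono_on_le_Limsup_at_top) simp
  \<comment> \<open>The differences q - p and g (q / p) - g 1 never have opposite strict signs, so
    their product is nonnegative. At p = 0 the bound \<open>g 1\<close> on the upper limit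
    \<open>L\<close> does the same.\<close>
  have le: "ereal (g 1 * (dens \<mu> Q x - dens \<mu> P x)) \<le> f x" for x
  proof (cases "dens \<mu> P x > 0")
    case True
    define p q where "p = dens \<mu> P x" and "q = dens \<mu> Q x"
    have pq: "0 < p" "0 \<le> q"
      using True by (auto simp: p_def q_def)
    have "g 1 * (q - p) \<le> (q - p) * g (q / p)"
    proof (cases "p \<le> q")
      case True
      then have "g 1 \<le> g (q / p)"
        using pq by (intro mono_onD[OF g]) auto
      then show ?thesis
        using mult_left_mono[of "g 1" "g (q / p)" "q - p"] True by (simp add: mult.commute)
    next
      case False
      then have "g (q / p) \<le> g 1"
        using pq by (intro mono_onD[OF g]) auto
      then show ?thesis
        using mult_left_mono_neg[of "g (q / p)" "g 1" "q - p"] False by (simp add: mult.commute)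
    qed
    then show ?thesis
      using True by (simp add: f_def p_def q_def Let_def)
  next
    case False
    then have p: "dens \<mu> P x = 0"
      using dens_nonneg[of \<mu> P x] by linarith
    have "ereal (dens \<mu> Q x) * ereal (g 1) \<le> ereal (dens \<mu> Q x) * L"
      using L by (intro ereal_mult_left_mono) auto
    then show ?thesis
      by (simp add: f_def p mult.commute)
  qed
  note fi = ext_integral_finite_imp_integrable[OF meas _ le fin[unfolded delta]]
  have ae: "AE x in \<mu>. f x = ereal (real_of_ereal (f x))"
    and int: "integrable \<mu> (\<lambda>x. real_of_ereal (f x))"
    using fi P Q by auto
  \<comment> \<open>This holds at every point, even for infinite \<open>L\<close>: where p = 0 both
    sides are then 0, as \<open>real_of_ereal\<close> sends infinite values to 0.\<close>
  have f: "real_of_ereal (f x) = (dens \<mu> Q x - dens \<mu> P x) * comp_ratio \<mu> Q P g l x" for x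
    by (auto simp: f_def comp_ratio_def l_def L_def Let_def dens_pos_iff)
  show "integrable \<mu> (\<lambda>x. (dens \<mu> Q x - dens \<mu> P x) * comp_ratio \<mu> Q P g l x)"
    using int unfolding f .
  then show "delta_div \<mu> g Q P =
      ereal (\<integral>x. (dens \<mu> Q x - dens \<mu> P x) * comp_ratio \<mu> Q P g l x \<partial>\<mu>)"
    unfolding delta using ae by (intro ext_integral_eq_integral) (simp_all add: f)
  show "AE x in \<mu>. dens \<mu> P x > 0 \<or> dens \<mu> Q x = 0 \<or> (g \<longlongrightarrow> l) at_top"
    using ae
  proof eventually_elim
    case (elim x)
    have "(g \<longlongrightarrow> l) at_top" if "\<not> dens \<mu> P x > 0" "dens \<mu> Q x \<noteq> 0"
    proof -
      have "dens \<mu> Q x > 0"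
        using that dens_nonneg[of \<mu> Q x] by linarith
      \<comment> \<open>With q > 0 an infinite \<open>L\<close> would make \<open>f x\<close>
        infinite, contrary to the choice of x.\<close>
      then have "L = ereal l"
        using that elim L unfolding l_def L_def[symmetric] by (cases L) (auto simp: f_def)
      then show ?thesis
        using mono_on_tendsto_at_top[OF g] by (simp add: L_def)
    qed
    then show ?case by blast
  qed
qed

text \<open>The first factor compares the ratios q / p at x and y without dividing. If both
  densities p are positive it is their product times the difference of the ratios. If only p x = 0,
  it is q x * p y, which is either 0 or comes with the value l, an upper bound of g; the case p y =
  0 is symmetric, and if both vanish the factor is 0.\<close>

lemma comp_ratio_mono:
  assumes g: "mono_on {0..} g"
    and x: "dens \<mu> P x > 0 \<or> dens \<mu> Q x = 0 \<or> (g \<longlongrightarrow> l) at_top"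
    and y: "dens \<mu> P y > 0 \<or> dens \<mu> Q y = 0 \<or> (g \<longlongrightarrow> l) at_top"
  shows "0 \<le> (dens \<mu> Q x * dens \<mu> P y - dens \<mu> Q y * dens \<mu> P x) *
    (comp_ratio \<mu> Q P g l x - comp_ratio \<mu> Q P g l y)"
proof -
  have lim: "g t \<le> l" if "(g \<longlongrightarrow> l) at_top" "0 \<le> t" for t
  proof (rule tendsto_lowerbound[OF that(1)])
    show "eventually (\<lambda>s. g t \<le> g s) at_top"
      using eventually_ge_at_top[of t]
      by eventually_elim (use g that in \<open>auto intro: mono_onD\<close>)
  qed simp
  have nn: "0 \<le> dens \<mu> Q z / dens \<mu> P z" for z by simp
  consider (pos) "dens \<mu> P x > 0" "dens \<mu> P y > 0"
    | (x0) "dens \<mu> P x = 0" "dens \<mu> P y > 0"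
    | (y0) "dens \<mu> P x > 0" "dens \<mu> P y = 0"
    | (zero) "dens \<mu> P x = 0" "dens \<mu> P y = 0"
    using dens_pos_iff[of \<mu> P x] dens_pos_iff[of \<mu> P y] by blast
  then show ?thesis
  proof cases
    case pos
    define r where "r z = dens \<mu> Q z / dens \<mu> P z" for z
    have "dens \<mu> Q x * dens \<mu> P y - dens \<mu> Q y * dens \<mu> P x =
      (dens \<mu> P x * dens \<mu> P y) * (r x - r y)"
      using pos by (simp add: r_def field_simps)
    moreover have "0 \<le> (r x - r y) * (g (r x) - g (r y))"
    proof (cases "r x \<le> r y")
      case True
      then have "g (r x) \<le> g (r y)"
        using nn by (intro mono_onD[OF g]) (auto simp: r_def)
      then show ?thesis
        using True by (simp add: mult_nonpos_nonpos)
    next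
      case False
      then have "g (r y) \<le> g (r x)"
        using nn by (intro mono_onD[OF g]) (auto simp: r_def)
      then show ?thesis
        using False by simp
    qed
    ultimately show ?thesis
      using pos by (simp add: comp_ratio_def mult.assoc flip: r_def)
  next
    case x0
    then show ?thesis
      using x lim[OF _ nn[of y]] by (auto simp: comp_ratio_def)
  next
    case y0
    then show ?thesis
      using y lim[OF _ nn[of x]] by (auto simp: comp_ratio_def mult_nonneg_nonpos)
  qed simp
qed

section \<open>The inequality for delta-divergences\<close>

theorem theorem9:
  fixes \<mu> P Q :: "'a measure" and g :: "real \<Rightarrow> real"
  assumes "sigma_finite_measure \<mu>"
    and "infinite (sets \<mu>) \<or> card (sets \<mu>) > 2"
    and "P \<in> prob_measures_ac \<mu>" and "Q \<in> prob_measures_ac \<mu>"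
    and "mono_on {0..} g"
  shows "delta_div \<mu> g Q P \<ge>
           max \<bar>abs_delta_div \<mu> g Q P - ereal (total_var \<mu> Q P) * h_div \<mu> g Q P\<bar>
               \<bar>abs_delta_div \<mu> (\<lambda>t. \<bar>g t\<bar>) Q P
                  - ereal (total_var \<mu> Q P) * h_div \<mu> (\<lambda>t. \<bar>g t\<bar>) Q P\<bar>
       \<and> max \<bar>abs_delta_div \<mu> g Q P - ereal (total_var \<mu> Q P) * h_div \<mu> g Q P\<bar>
             \<bar>abs_delta_div \<mu> (\<lambda>t. \<bar>g t\<bar>) Q P
                - ereal (total_var \<mu> Q P) * h_div \<mu> (\<lambda>t. \<bar>g t\<bar>) Q P\<bar> \<ge> 0"
proof -
  let ?p = "dens \<mu> P" and ?q = "dens \<mu> Q"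
  note p = dens_prob[OF assms(1,3)] and q = dens_prob[OF assms(1,4)]
  note g = assms(5)
  show ?thesis
  proof (cases "delta_div \<mu> g Q P = \<infinity>")
    case True
    then show ?thesis
      by (simp add: le_max_iff_disj)
  next
    case False
    define l where "l = real_of_ereal (Limsup at_top (\<lambda>t. ereal (g t)))"
    define R where "R x \<longleftrightarrow> ?p x > 0 \<or> ?q x = 0 \<or> (g \<longlongrightarrow> l) at_top" for x
    define G where "G = comp_ratio \<mu> Q P g l"
    note fin = delta_div_finite_imp_integrable[OF p(1) q(1) g False, folded l_def, folded R_def G_def]
    have pG: "integrable \<mu> (\<lambda>x. ?p x * G x)"
      using integrable_dens_mult_comp_ratio[OF g p(1)] fin(2) unfolding G_def .
    have "integrable \<mu> (\<lambda>x. (?q x - ?p x) * G x + ?p x * G x)"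
      using fin(2) pG by (rule Bochner_Integration.integrable_add)
    then have qG: "integrable \<mu> (\<lambda>x. ?q x * G x)"
      by (simp add: algebra_simps)
    have [measurable]: "G \<in> borel_measurable \<mu>"
      unfolding G_def by (rule measurable_comp_ratio[OF g])
    \<comment> \<open>Both entries of the maximum are instances, with h = g and h = |g|.
      Monotonicity of h is not asked for: equal absolute values carry integrability over from
      \<open>G\<close>, and the Lipschitz condition is what the Chebyshev bound uses.\<close>
    have bound: "\<bar>abs_delta_div \<mu> h Q P - ereal (total_var \<mu> Q P) * h_div \<mu> h Q P\<bar>
        \<le> delta_div \<mu> g Q P"
      if lim: "(g \<longlongrightarrow> l) at_top \<Longrightarrow> (h \<longlongrightarrow> c) at_top"
        and [measurable]: "comp_ratio \<mu> Q P h c \<in> borel_measurable \<mu>"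
        and abs_eq: "\<And>x. \<bar>comp_ratio \<mu> Q P h c x\<bar> = \<bar>G x\<bar>"
        and lip: "\<And>x y. \<bar>comp_ratio \<mu> Q P h c x - comp_ratio \<mu> Q P h c y\<bar> \<le> \<bar>G x - G y\<bar>"
      for h c
    proof -
      define H where "H = comp_ratio \<mu> Q P h c"
      have [measurable]: "H \<in> borel_measurable \<mu>"
        unfolding H_def by fact
      have pH: "integrable \<mu> (\<lambda>x. ?p x * H x)"
        by (rule Bochner_Integration.integrable_bound[OF pG])
          (auto simp: abs_mult H_def abs_eq)
      have aH: "integrable \<mu> (\<lambda>x. \<bar>?q x - ?p x\<bar> * H x)"
        by (rule Bochner_Integration.integrable_bound[OF fin(2)])
          (auto simp: abs_mult H_def abs_eq)
      have ae: "AE x in \<mu>. ?p x > 0 \<or> ?q x = 0 \<or> (h \<longlongrightarrow> c) at_top"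
        using fin(1) by eventually_elim (use lim in \<open>auto simp: R_def\<close>)
      have "\<bar>(\<integral>x. \<bar>?q x - ?p x\<bar> * H x \<partial>\<mu>) - (\<integral>x. \<bar>?q x - ?p x\<bar> \<partial>\<mu>) * (\<integral>x. ?p x * H x \<partial>\<mu>)\<bar>
          \<le> (\<integral>x. (?q x - ?p x) * G x \<partial>\<mu>)"
      proof (rule chebyshev_functional_bound[OF p(1) q(1) pG qG pH aH p(2) q(2) dens_nonneg fin(1)])
        fix x y
        assume "R x" "R y"
        then show "0 \<le> (?q x * ?p y - ?q y * ?p x) * (G x - G y)"
          unfolding R_def G_def by (rule comp_ratio_mono[OF g])
        show "\<bar>H x - H y\<bar> \<le> \<bar>G x - G y\<bar>"
          unfolding H_def by (rule lip)
      qed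
      then show ?thesis
        using h_div_eq_integral[OF pH[unfolded H_def] ae]
          abs_delta_div_eq_integral[OF aH[unfolded H_def] ae] fin(3)
        by (simp add: total_var_def H_def)
    qed
    have "\<bar>abs_delta_div \<mu> g Q P - ereal (total_var \<mu> Q P) * h_div \<mu> g Q P\<bar> \<le> delta_div \<mu> g Q P"
      by (rule bound[of _ l]) (auto simp flip: G_def)
    moreover have "\<bar>abs_delta_div \<mu> (\<lambda>t. \<bar>g t\<bar>) Q P
        - ereal (total_var \<mu> Q P) * h_div \<mu> (\<lambda>t. \<bar>g t\<bar>) Q P\<bar> \<le> delta_div \<mu> g Q P"
    \<comment> \<open>Although |g| need not be monotone, its composed ratio is |G|, and the
      Lipschitz condition becomes the reverse triangle inequality.\<close>
    proof (rule bound[of _ "\<bar>l\<bar>"])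
      have [simp]: "comp_ratio \<mu> Q P (\<lambda>t. \<bar>g t\<bar>) \<bar>l\<bar> = (\<lambda>x. \<bar>G x\<bar>)"
        by (auto simp: abs_comp_ratio G_def)
      show "comp_ratio \<mu> Q P (\<lambda>t. \<bar>g t\<bar>) \<bar>l\<bar> \<in> borel_measurable \<mu>"
        by simp
      show "\<bar>comp_ratio \<mu> Q P (\<lambda>t. \<bar>g t\<bar>) \<bar>l\<bar> x\<bar> = \<bar>G x\<bar>" for x
        by simp
      show "\<bar>comp_ratio \<mu> Q P (\<lambda>t. \<bar>g t\<bar>) \<bar>l\<bar> x - comp_ratio \<mu> Q P (\<lambda>t. \<bar>g t\<bar>) \<bar>l\<bar> y\<bar>
          \<le> \<bar>G x - G y\<bar>" for x y
        by simp
    qed (rule tendsto_rabs)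
    ultimately show ?thesis
      by (simp add: le_max_iff_disj)
  qed
qed

end
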